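(* Let $\alpha\in\mathcal{A}$. Suppose that the reduced-order problem $(RP_\alpha)$ and the semi-reduced problem $(R_PP_\alpha)$ have the same optimal value, i.e. $I_R(\alpha)=I_{R_P}(\alpha)$. Let $(a^*(\alpha),b^*(\alpha))\in\mathbb{R}^N\times\mathbb{R}^M$ be a solution of the reduced dual problem $(RD_\alpha)$, and set $\widehat{\varphi}_*=\widehat{U}a^*(\alpha)\in\mathbb{R}^{\mathcal{N}_x}$ and $\widehat{\psi}_*=\widehat{V}b^*(\alpha)\in\mathbb{R}^{\mathcal{N}_y}$. Then $$0\le I_R(\alpha)-I(\alpha)\le\min\Big(\big\langle\widehat{\psi}_*-\widehat{\varphi}_*^{\,c},\ \nu(\alpha)\big\rangle,\ \big\langle\widehat{\varphi}_*-\widehat{\psi}_*^{\,\bar c},\ \mu(\alpha)\big\rangle\Big).$$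
   Context: Let $\mathcal{N}_x,\mathcal{N}_y,K_x,K_y\ge 1$ be integers, $X=\{x_1,\dots,x_{\mathcal{N}_x}\}$, $Y=\{y_1,\dots,y_{\mathcal{N}_y}\}$ finite sets, $c:X\times Y\to\mathbb{R}_+$ a cost function and $C=(C_{ij})$, $C_{ij}=c(x_i,y_j)$, the cost matrix. Let $\mu_1,\dots,\mu_{K_x}\in\mathbb{R}_+^{\mathcal{N}_x}$ and $\nu_1,\dots,\nu_{K_y}\in\mathbb{R}_+^{\mathcal{N}_y}$ be probability vectors. The parameter set is $$\mathcal{A}=\Big\{\alpha=(\alpha^x,\alpha^y)\in\mathbb{R}_+^{K_x+K_y}:\ \sum_{k=1}^{K_x}\alpha^x_k=1,\ \sum_{l=1}^{K_y}\alpha^y_l=1\Big\},$$ and $\mu(\alpha)=\sum_k\alpha^x_k\mu_k$, $\nu(\alpha)=\sum_l\alpha^y_l\nu_l$. A matrix $\Pi\in\mathbb{R}^{\mathcal{N}_x\times\mathcal{N}_y}$ is identified with the vector $\pi\in\mathbb{R}^{\mathcal{N}_x\mathcal{N}_y}$ obtained by stacking columns, $\pi_{i+(j-1)\mathcal{N}_x}=\Pi_{ij}$; let $\mathbf{c}$ be the vector associated with $C$. Let $A\in\mathbb{R}^{(\mathcal{N}_x+\mathcal{N}_y)\times\mathcal{N}_x\mathcal{N}_y}$ be the marginal constraint matrix: $(A\pi)_i=\sum_{j}\Pi_{ij}$ for $1\le i\le\mathcal{N}_x$ and $(A\pi)_{\mathcal{N}_x+j}=\sum_i\Pi_{ij}$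 for $1\le j\le\mathcal{N}_y$. The high-fidelity problem is $$(P_\alpha):\quad I(\alpha)=\min\Big\{\langle\pi,\mathbf{c}\rangle:\ \pi\in\mathbb{R}_+^{\mathcal{N}_x\mathcal{N}_y},\ A\pi=\begin{pmatrix}\mu(\alpha)\\ \nu(\alpha)\end{pmatrix}\Big\}.$$ Reduced objects: $\alpha_1,\dots,\alpha_R\in\mathcal{A}$ are finitely many training parameters, $\pi_*(\alpha_r)$ is a solution of $(P_{\alpha_r})$, and $\widehat{W}=(\pi_*(\alpha_1)|\cdots|\pi_*(\alpha_R))$. Let $\widehat{U}\in\mathbb{R}^{\mathcal{N}_x\times N}$, $\widehat{V}\in\mathbb{R}^{\mathcal{N}_y\times M}$, $\widehat{S}=\begin{pmatrix}\widehat{U}&0\\0&\widehat{V}\end{pmatrix}$. Then $$(R_PP_\alpha):\quad I_{R_P}(\alpha)=\inf\Big\{\langle p,\widehat{W}^T\mathbf{c}\rangle:\ p\in\mathbb{R}_+^R,\ A\widehat{W}p=\begin{pmatrix}\mu(\alpha)\\ \nu(\alpha)\end{pmatrix}\Big\},$$ $$(RP_\alpha):\quad I_R(\alpha)=\inf\Big\{\langle p,\widehat{W}^T\mathbf{c}\rangle:\ p\in\mathbb{R}_+^R,\ \widehat{S}^TA\widehat{W}p=\widehat{S}^T\begin{pmatrix}\mu(\alpha)\\ \nu(\alpha)\end{pmatrix}\Big\},$$ and the dual of $(RP_\alpha)$ is $$(RD_\alpha):\quad J_R(\alpha)=\sup\Big\{\langle a,\widehat{U}^T\mu(\alpha)\rangle+\langle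 b,\widehat{V}^T\nu(\alpha)\rangle:\ (a,b)\in\mathbb{R}^{N}\times\mathbb{R}^M,\ \widehat{W}^TA^T\widehat{S}\begin{pmatrix}a\\ b\end{pmatrix}\le\widehat{W}^T\mathbf{c}\Big\},$$ a solution being a maximizer. Discrete $c$-transforms: for $\varphi\in\mathbb{R}^{\mathcal{N}_x}$, $\varphi^c\in\mathbb{R}^{\mathcal{N}_y}$ is $\varphi^c_j=\min_{1\le i\le\mathcal{N}_x}(C_{ij}-\varphi_i)$; for $\psi\in\mathbb{R}^{\mathcal{N}_y}$, $\psi^{\bar c}\in\mathbb{R}^{\mathcal{N}_x}$ is $\psi^{\bar c}_i=\min_{1\le j\le\mathcal{N}_y}(C_{ij}-\psi_j)$. *)

theory Defs
  imports "HOL-Analysis.Analysis"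
begin

definition prob_vector :: "real ^ 'a::finite \<Rightarrow> bool" where
  "prob_vector v \<longleftrightarrow> 0 \<le> v \<and> (\<Sum>i\<in>UNIV. v $ i) = 1"

definition param_set :: "((real ^ 'kx::finite) \<times> (real ^ 'ky::finite)) set" where
  "param_set = {(ax, ay). prob_vector ax \<and> prob_vector ay}"

definition mixture :: "('k::finite \<Rightarrow> real ^ 'a::finite) \<Rightarrow> real ^ 'k \<Rightarrow> real ^ 'a" where
  "mixture \<mu> a = (\<Sum>k\<in>UNIV. a $ k *\<^sub>R \<mu> k)"

definition cost_matrix ::
    "('a \<times> 'b \<Rightarrow> real) \<Rightarrow> ('nx::finite \<Rightarrow> 'a) \<Rightarrow> ('ny::finite \<Rightarrow> 'b) \<Rightarrow> real ^ 'ny ^ 'nx" where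
  "cost_matrix c x y = (\<chi> i j. c (x i, y j))"

text \<open>The vectorization of a matrix is indexed by the pairs \<open>(i, j)\<close>; the pair plays the role of
  the column-stacking index \<open>i + (j - 1) * CARD('nx)\<close>. Likewise, stacked vectors and block
  matrices are indexed by the disjoint sum of the index types of the blocks.\<close>

definition vectorize :: "real ^ 'ny::finite ^ 'nx::finite \<Rightarrow> real ^ ('nx \<times> 'ny)" where
  "vectorize P = (\<chi> p. P $ fst p $ snd p)"

definition stack :: "real ^ 'a::finite \<Rightarrow> real ^ 'b::finite \<Rightarrow> real ^ ('a + 'b)" where
  "stack u v = (\<chi> s. case s of Inl i \<Rightarrow> u $ i | Inr j \<Rightarrow> v $ j)"

definition block_diag ::
    "real ^ 'n::finite ^ 'a::finite \<Rightarrow> real ^ 'm::finite ^ 'b::finite \<Rightarrow> real ^ ('n + 'm) ^ ('a + 'b)" where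
  "block_diag U V = (\<chi> s t. case s of
      Inl i \<Rightarrow> (case t of Inl k \<Rightarrow> U $ i $ k | Inr l \<Rightarrow> 0)
    | Inr j \<Rightarrow> (case t of Inl k \<Rightarrow> 0 | Inr l \<Rightarrow> V $ j $ l))"

definition marginal_matrix :: "real ^ ('nx::finite \<times> 'ny::finite) ^ ('nx + 'ny)" where
  "marginal_matrix = (\<chi> s p. case s of
      Inl i \<Rightarrow> (if fst p = i then 1 else 0)
    | Inr j \<Rightarrow> (if snd p = j then 1 else 0))"

lemma marginal_matrix_mult:
  fixes p :: "real ^ ('nx::finite \<times> 'ny::finite)"
  shows "(marginal_matrix *v p) $ Inl i = (\<Sum>j\<in>UNIV. p $ (i, j))"
    and "(marginal_matrix *v p) $ Inr j = (\<Sum>i\<in>UNIV. p $ (i, j))"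
proof -
  have *: "(\<Sum>q\<in>UNIV. f q) = (\<Sum>i\<in>UNIV. \<Sum>j\<in>UNIV. f (i, j))" for f :: "'nx \<times> 'ny \<Rightarrow> real"
    by (simp add: sum.cartesian_product)
  have if0: "(if b then 1 else 0) * r = (if b then r else 0)" for b and r :: real
    by simp
  show "(marginal_matrix *v p) $ Inl i = (\<Sum>j\<in>UNIV. p $ (i, j))"
    unfolding marginal_matrix_def matrix_vector_mult_def
    by (simp add: * if0) (subst sum.swap, simp)
  show "(marginal_matrix *v p) $ Inr j = (\<Sum>i\<in>UNIV. p $ (i, j))"
    unfolding marginal_matrix_def matrix_vector_mult_def
    by (simp add: * if0)
qed

text \<open>The three primal problems are standard-form linear programs: minimize \<open>p \<bullet> q\<close> over
  \<open>p \<ge> 0\<close> with \<open>B p = d\<close>. Values are extended reals, so that an infeasible problem has value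
  \<open>\<infinity>\<close>. The full transport problem has a nonempty compact feasible set when both marginals are
  probability vectors, so there the infimum is the minimum.\<close>

definition lp_feasible :: "real ^ 'n::finite ^ 'm::finite \<Rightarrow> real ^ 'm \<Rightarrow> (real ^ 'n) set" where
  "lp_feasible B d = {p. 0 \<le> p \<and> B *v p = d}"

definition lp_value ::
    "real ^ 'n::finite ^ 'm::finite \<Rightarrow> real ^ 'm \<Rightarrow> real ^ 'n \<Rightarrow> ereal" where
  "lp_value B d q = (INF p\<in>lp_feasible B d. ereal (p \<bullet> q))"

definition lp_solution ::
    "real ^ 'n::finite ^ 'm::finite \<Rightarrow> real ^ 'm \<Rightarrow> real ^ 'n \<Rightarrow> real ^ 'n \<Rightarrow> bool" where
  "lp_solution B d q p \<longleftrightarrow> is_arg_min (\<lambda>p. p \<bullet> q) (\<lambda>p. p \<in> lp_feasible B d) p"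

definition ot_value ::
    "real ^ 'ny::finite ^ 'nx::finite \<Rightarrow> real ^ 'nx \<Rightarrow> real ^ 'ny \<Rightarrow> ereal" where
  "ot_value C m n = lp_value marginal_matrix (stack m n) (vectorize C)"

definition ot_solution ::
    "real ^ 'ny::finite ^ 'nx::finite \<Rightarrow> real ^ 'nx \<Rightarrow> real ^ 'ny \<Rightarrow> real ^ ('nx \<times> 'ny) \<Rightarrow> bool" where
  "ot_solution C m n p \<longleftrightarrow> lp_solution marginal_matrix (stack m n) (vectorize C) p"

definition snapshot_matrix :: "('r::finite \<Rightarrow> real ^ 'a::finite) \<Rightarrow> real ^ 'r ^ 'a" where
  "snapshot_matrix w = (\<chi> q r. w r $ q)"

definition semi_reduced_value ::
    "real ^ 'ny::finite ^ 'nx::finite \<Rightarrow> real ^ 'r::finite ^ ('nx \<times> 'ny)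
      \<Rightarrow> real ^ 'nx \<Rightarrow> real ^ 'ny \<Rightarrow> ereal" where
  "semi_reduced_value C W m n =
    lp_value (marginal_matrix ** W) (stack m n) (transpose W *v vectorize C)"

definition reduced_value ::
    "real ^ 'ny::finite ^ 'nx::finite \<Rightarrow> real ^ 'r::finite ^ ('nx \<times> 'ny)
      \<Rightarrow> real ^ 'n::finite ^ 'nx \<Rightarrow> real ^ 'm::finite ^ 'ny
      \<Rightarrow> real ^ 'nx \<Rightarrow> real ^ 'ny \<Rightarrow> ereal" where
  "reduced_value C W U V m n =
    lp_value (transpose (block_diag U V) ** marginal_matrix ** W)
      (transpose (block_diag U V) *v stack m n) (transpose W *v vectorize C)"

definition reduced_dual_feasible ::
    "real ^ 'ny::finite ^ 'nx::finite \<Rightarrow> real ^ 'r::finite ^ ('nx \<times> 'ny)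
      \<Rightarrow> real ^ 'n::finite ^ 'nx \<Rightarrow> real ^ 'm::finite ^ 'ny
      \<Rightarrow> ((real ^ 'n) \<times> (real ^ 'm)) set" where
  "reduced_dual_feasible C W U V =
    {(a, b). (transpose W ** transpose marginal_matrix ** block_diag U V) *v stack a b
               \<le> transpose W *v vectorize C}"

definition reduced_dual_solution ::
    "real ^ 'ny::finite ^ 'nx::finite \<Rightarrow> real ^ 'r::finite ^ ('nx \<times> 'ny)
      \<Rightarrow> real ^ 'n::finite ^ 'nx \<Rightarrow> real ^ 'm::finite ^ 'ny
      \<Rightarrow> real ^ 'nx \<Rightarrow> real ^ 'ny \<Rightarrow> (real ^ 'n) \<times> (real ^ 'm) \<Rightarrow> bool" where
  "reduced_dual_solution C W U V m n ab \<longleftrightarrow>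
    is_arg_max (\<lambda>(a, b). a \<bullet> (transpose U *v m) + b \<bullet> (transpose V *v n))
      (\<lambda>ab. ab \<in> reduced_dual_feasible C W U V) ab"

definition c_transform :: "real ^ 'ny::finite ^ 'nx::finite \<Rightarrow> real ^ 'nx \<Rightarrow> real ^ 'ny" where
  "c_transform C \<phi> = (\<chi> j. MIN i. C $ i $ j - \<phi> $ i)"

definition cbar_transform :: "real ^ 'ny::finite ^ 'nx::finite \<Rightarrow> real ^ 'ny \<Rightarrow> real ^ 'nx" where
  "cbar_transform C \<psi> = (\<chi> i. MIN j. C $ i $ j - \<psi> $ j)"

end

(* Weak duality with the pair (phi, phi^c), and symmetrically with (psi^c, psi), bounds I(alpha)
   from below. A separation argument shows that attainment in the reduced dual already forces the
   reduced primal to be feasible with value at most the dual value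
   <phi, mu(alpha)> + <psi, nu(alpha)>. Subtracting gives the upper estimate. The lower one holds
   since W maps semi-reduced feasible points to transport plans of the same cost. *)

theory Submission
  imports Defs
begin

text \<open>As a simp rule it would turn \<open>transpose B *v z\<close> into \<open>z v* B\<close>;
  the dual constraints are kept in the transposed form throughout.\<close>

declare transpose_matrix_vector [simp del]

section \<open>Linear programming duality\<close>

lemma inner_matrix_vector_transpose:
  fixes B :: "real ^ 'n::finite ^ 'm::finite"
  shows "z \<bullet> (B *v p) = (transpose B *v z) \<bullet> p"
  by (metis dot_lmul_matrix transpose_matrix_vector)

lemma inner_vec_right_mono:
  fixes u v p :: "real ^ 'n::finite"
  assumes "u \<le> v" and "0 \<le> p"
  shows "u \<bullet> p \<le> v \<bullet> p"
  using assms by (auto simp: inner_vec_def less_eq_vec_def intro!: sum_mono mult_right_mono)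

lemma lp_weak_duality:
  assumes "transpose B *v z \<le> q" and "p \<in> lp_feasible B d"
  shows "z \<bullet> d \<le> p \<bullet> q"
proof -
  have p: "0 \<le> p" "B *v p = d"
    using assms(2) by (auto simp: lp_feasible_def)
  then have "z \<bullet> d = (transpose B *v z) \<bullet> p"
    by (metis inner_matrix_vector_transpose)
  also have "\<dots> \<le> q \<bullet> p"
    by (rule inner_vec_right_mono[OF assms(1) p(1)])
  finally show ?thesis
    by (simp add: inner_commute)
qed

lemma lp_weak_duality_value:
  assumes "transpose B *v z \<le> q"
  shows "ereal (z \<bullet> d) \<le> lp_value B d q"
  unfolding lp_value_def using lp_weak_duality[OF assms] by (auto intro!: INF_greatest)

text \<open>Farkas-type argument: if \<open>(d, z \<bullet> d)\<close> lay outside the closed cone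
  generated by the columns of \<open>B\<close> paired with their costs, a separating functional
  would yield a dual feasible point better than \<open>z\<close>. Primal feasibility is thus a
  consequence of dual attainment.\<close>

lemma lp_strong_duality:
  fixes B :: "real ^ 'n::finite ^ 'm::finite"
  assumes feas: "transpose B *v z \<le> q"
    and opt: "\<And>z'. transpose B *v z' \<le> q \<Longrightarrow> z' \<bullet> d \<le> z \<bullet> d"
  obtains p where "p \<in> lp_feasible B d" and "p \<bullet> q \<le> z \<bullet> d"
proof -
  \<comment> \<open>The generator \<open>(0, 1)\<close> adds slack in the cost coordinate. Being
    finitely generated, \<open>H\<close> is closed; \<open>K\<close> is an explicit cone containing
    it, from which a primal point and its slack can be read off.\<close>
  define G where "G = insert (0, 1) (range (\<lambda>r. (B *v axis r 1, q $ r)))"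
  define H where "H = convex_cone hull G"
  define K where "K = {(B *v p, p \<bullet> q + s) | p s. 0 \<le> p \<and> 0 \<le> s}"
  have "convex_cone K"
    unfolding convex_cone_iff
  proof (intro conjI ballI allI impI)
    show "0 \<in> K"
      unfolding K_def by (auto intro!: exI[of _ 0] simp: zero_prod_def)
  next
    fix u v assume "u \<in> K" "v \<in> K"
    then obtain p s p' s' where "u = (B *v p, p \<bullet> q + s)" "v = (B *v p', p' \<bullet> q + s')"
      and nonneg: "0 \<le> p" "0 \<le> s" "0 \<le> p'" "0 \<le> s'"
      unfolding K_def by blast
    then have "u + v = (B *v (p + p'), (p + p') \<bullet> q + (s + s'))"
      by (simp add: matrix_vector_right_distrib inner_add_left)
    moreover have "0 \<le> p + p'" "0 \<le> s + s'"
      using nonneg by (auto simp: less_eq_vec_def)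
    ultimately show "u + v \<in> K"
      unfolding K_def by blast
  next
    fix u and k :: real assume "u \<in> K" "0 \<le> k"
    then obtain p s where "u = (B *v p, p \<bullet> q + s)" and nonneg: "0 \<le> p" "0 \<le> s"
      unfolding K_def by blast
    then have "k *\<^sub>R u = (B *v (k *\<^sub>R p), (k *\<^sub>R p) \<bullet> q + k * s)"
      by (simp add: matrix_vector_mult_scaleR distrib_left)
    moreover have "0 \<le> k *\<^sub>R p" "0 \<le> k * s"
      using nonneg \<open>0 \<le> k\<close> by (auto simp: less_eq_vec_def)
    ultimately show "k *\<^sub>R u \<in> K"
      unfolding K_def by blast
  qed
  moreover have "G \<subseteq> K"
  proof -
    have "(0, 1) \<in> K"
      unfolding K_def mem_Collect_eq by (rule exI[of _ 0], rule exI[of _ 1]) simp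
    moreover have "(B *v axis r 1, q $ r) \<in> K" for r
      unfolding K_def mem_Collect_eq
      by (rule exI[of _ "axis r 1"], rule exI[of _ 0])
        (simp add: inner_axis')
    ultimately show ?thesis
      by (auto simp: G_def)
  qed
  ultimately have "H \<subseteq> K"
    unfolding H_def by (metis hull_minimal)
  have "(d, z \<bullet> d) \<in> H"
  proof (rule ccontr)
    assume "(d, z \<bullet> d) \<notin> H"
    moreover have "convex H" "closed H"
      unfolding H_def by (auto simp: convex_convex_cone_hull closed_convex_cone_hull G_def)
    ultimately obtain wt \<beta> where sep0: "wt \<bullet> (d, z \<bullet> d) < \<beta>" "\<forall>x\<in>H. \<beta> < wt \<bullet> x"
      using separating_hyperplane_closed_point by blast
    obtain w t where wt: "wt = (w, t)"
      by fastforce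
    have "\<beta> < 0"
      using sep0(2) convex_cone_hull_contains_0[of G] by (force simp: H_def)
    \<comment> \<open>A functional bounded below on a cone cannot be negative on a generator: the
      positive multiple by \<open>\<beta> / (wt \<bullet> g)\<close> would take exactly the value
      \<open>\<beta>\<close>, against strict separation.\<close>
    have nonneg: "0 \<le> wt \<bullet> g" if "g \<in> G" for g
    proof (rule ccontr)
      assume neg: "\<not> 0 \<le> wt \<bullet> g"
      have "g \<in> H"
        using that by (simp add: H_def hull_inc)
      then have "(\<beta> / (wt \<bullet> g)) *\<^sub>R g \<in> H"
        using neg \<open>\<beta> < 0\<close> unfolding H_def
        by (intro convex_cone_hull_mul) (auto simp: divide_nonpos_neg)
      with sep0(2) have "\<beta> < wt \<bullet> ((\<beta> / (wt \<bullet> g)) *\<^sub>R g)"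
        by blast
      with neg show False
        by auto
    qed
    have "0 \<le> t"
      using nonneg[of "(0, 1)"] by (simp add: G_def wt)
    have ge: "0 \<le> (transpose B *v w) $ r + t * q $ r" for r
      using nonneg[of "(B *v axis r 1, q $ r)"]
      by (simp add: G_def wt inner_matrix_vector_transpose inner_axis)
    have lt: "w \<bullet> d + t * (z \<bullet> d) < 0"
      using sep0(1) \<open>\<beta> < 0\<close> by (simp add: wt)
    show False
    proof (cases "t = 0")
      \<comment> \<open>Here \<open>- w\<close> is a recession direction of the dual feasible set
        along which the objective strictly increases, so \<open>z - w\<close> beats
        \<open>z\<close>.\<close>
      case True
      have "transpose B *v (z - w) \<le> q"
        unfolding less_eq_vec_def
      proof
        fix r
        show "(transpose B *v (z - w)) $ r \<le> q $ r"
          using ge[of r] feas True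
          by (simp add: matrix_vector_mult_diff_distrib less_eq_vec_def add_increasing2 algebra_simps)
      qed
      from opt[OF this] lt True show False
        by (simp add: inner_diff_left)
    next
      \<comment> \<open>Normalizing the cost coefficient to 1 makes \<open>- w / t\<close> itself
        dual feasible, with a value above \<open>z \<bullet> d\<close>.\<close>
      case False
      with \<open>0 \<le> t\<close> have "0 < t"
        by simp
      have "transpose B *v ((- 1 / t) *\<^sub>R w) \<le> q"
        unfolding less_eq_vec_def
      proof
        fix r
        show "(transpose B *v ((- 1 / t) *\<^sub>R w)) $ r \<le> q $ r"
          using ge[of r] \<open>0 < t\<close> unfolding matrix_vector_mult_scaleR
            by (simp add: field_simps)
      qed
      from opt[OF this] lt \<open>0 < t\<close> show False
        by (simp add: field_simps)
    qed
  qed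
  with \<open>H \<subseteq> K\<close> obtain p s where p: "d = B *v p" "z \<bullet> d = p \<bullet> q + s" "0 \<le> p" "0 \<le> s"
    unfolding K_def by blast
  have "p \<in> lp_feasible B d"
    using p(1,3) by (simp add: lp_feasible_def)
  moreover have "p \<bullet> q \<le> z \<bullet> d"
    using p(2,4) by simp
  ultimately show thesis
    by (rule that)
qed

section \<open>Stacked vectors and the marginal matrix\<close>

lemma sum_UNIV_Plus:
  fixes f :: "'a::finite + 'b::finite \<Rightarrow> real"
  shows "sum f UNIV = (\<Sum>i\<in>UNIV. f (Inl i)) + (\<Sum>j\<in>UNIV. f (Inr j))"
  by (simp only: UNIV_Plus_UNIV[symmetric] sum.Plus[OF finite finite] o_def)

lemma stack_nth [simp]:
  "stack u v $ Inl i = u $ i" "stack u v $ Inr j = v $ j"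
  by (simp_all add: stack_def)

lemma inner_stack: "stack u v \<bullet> stack m n = u \<bullet> m + v \<bullet> n"
  by (simp add: inner_vec_def sum_UNIV_Plus)

text \<open>Lets optimality over pairs \<open>(a, b)\<close> be used as optimality over all dual
  vectors.\<close>

lemma ex_stack: "\<exists>u v. z = stack u v"
proof (intro exI)
  show "z = stack (\<chi> i. z $ Inl i) (\<chi> j. z $ Inr j)"
    by (auto simp: vec_eq_iff stack_def split: sum.split)
qed

lemma block_diag_mult_stack: "block_diag U V *v stack a b = stack (U *v a) (V *v b)"
proof -
  have "(block_diag U V *v stack a b) $ s = stack (U *v a) (V *v b) $ s" for s
    by (cases s) (simp_all add: block_diag_def matrix_vector_mult_def sum_UNIV_Plus)
  then show ?thesis
    by (simp add: vec_eq_iff)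
qed

lemma transpose_marginal_matrix_mult_stack:
  "(transpose marginal_matrix *v stack u v) $ (i, j) = u $ i + v $ j"
proof -
  have if0: "(if P then 1 else 0) * r = (if P then r else 0)" for P and r :: real
    by simp
  show ?thesis
    by (simp add: matrix_vector_mult_def sum_UNIV_Plus transpose_def marginal_matrix_def if0)
qed

section \<open>Kantorovich weak duality and c-transforms\<close>

lemma ot_weak_duality:
  fixes C :: "real ^ 'ny::finite ^ 'nx::finite"
  assumes "\<And>i j. u $ i + v $ j \<le> C $ i $ j"
  shows "ereal (u \<bullet> m + v \<bullet> n) \<le> ot_value C m n"
proof -
  have "transpose marginal_matrix *v stack u v \<le> vectorize C"
    using assms
    by (auto simp: less_eq_vec_def transpose_marginal_matrix_mult_stack vectorize_def)
  from lp_weak_duality_value[OF this, of "stack m n"] show ?thesis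
    by (simp add: ot_value_def inner_stack)
qed

lemma c_transform_feasible: "\<phi> $ i + c_transform C \<phi> $ j \<le> C $ i $ j"
proof -
  have "c_transform C \<phi> $ j \<le> C $ i $ j - \<phi> $ i"
    by (simp add: c_transform_def)
  then show ?thesis
    by simp
qed

lemma cbar_transform_feasible: "cbar_transform C \<psi> $ i + \<psi> $ j \<le> C $ i $ j"
proof -
  have "cbar_transform C \<psi> $ i \<le> C $ i $ j - \<psi> $ j"
    by (simp add: cbar_transform_def)
  then show ?thesis
    by simp
qed

section \<open>Comparison of the reduced problems with their dual and with full transport\<close>

lemma reduced_dual_objective:
  "a \<bullet> (transpose U *v m) + b \<bullet> (transpose V *v n)
    = stack a b \<bullet> (transpose (block_diag U V) *v stack m n)"
  by (simp add: inner_matrix_vector_transpose block_diag_mult_stack inner_stack)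

text \<open>Up to stacking, the reduced dual is the linear programming dual for \<open>B\<close>,
  \<open>d\<close>, \<open>q\<close> below, so a maximizer produces a primal point whose cost is at
  most the maximum. In particular the reduced value is not \<infinity>.\<close>

lemma reduced_value_le_dual:
  assumes "reduced_dual_solution C W U V m n (a, b)"
  shows "reduced_value C W U V m n \<le> ereal ((U *v a) \<bullet> m + (V *v b) \<bullet> n)"
proof -
  define B where "B = transpose (block_diag U V) ** marginal_matrix ** W"
  define d where "d = transpose (block_diag U V) *v stack m n"
  define q where "q = transpose W *v vectorize C"
  have feasible: "(a', b') \<in> reduced_dual_feasible C W U V
      \<longleftrightarrow> transpose B *v stack a' b' \<le> q" for a' b'
    by (simp add: reduced_dual_feasible_def B_def q_def matrix_transpose_mul matrix_mul_assoc)
  have objective: "a' \<bullet> (transpose U *v m) + b' \<bullet> (transpose V *v n) = stack a' b' \<bullet> d" for a' b'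
    by (simp add: reduced_dual_objective d_def)
  have "transpose B *v stack a b \<le> q"
    using assms by (simp add: reduced_dual_solution_def is_arg_max_def feasible)
  moreover have "z \<bullet> d \<le> stack a b \<bullet> d" if "transpose B *v z \<le> q" for z
  proof -
    obtain a' b' where z: "z = stack a' b'"
      using ex_stack by blast
    show ?thesis
      using assms that unfolding z
      by (fastforce simp: reduced_dual_solution_def is_arg_max_def objective feasible not_less)
  qed
  ultimately obtain p where "p \<in> lp_feasible B d" "p \<bullet> q \<le> stack a b \<bullet> d"
    using lp_strong_duality by blast
  then have "lp_value B d q \<le> ereal (stack a b \<bullet> d)"
    unfolding lp_value_def by (meson INF_lower2 ereal_less_eq(3))
  moreover have "stack a b \<bullet> d = (U *v a) \<bullet> m + (V *v b) \<bullet> n"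
    by (simp add: d_def inner_matrix_vector_transpose block_diag_mult_stack inner_stack)
  ultimately show ?thesis
    by (simp add: reduced_value_def B_def d_def q_def)
qed

text \<open>A nonnegative \<open>W\<close> sends feasible \<open>p\<close> to a transport plan
  \<open>W *v p\<close> with the same marginals and cost. An infeasible semi-reduced problem has
  value \<infinity>, so the bound covers that case too.\<close>

lemma ot_value_le_semi_reduced_value:
  fixes W :: "real ^ 'r::finite ^ ('nx::finite \<times> 'ny::finite)"
  assumes "\<And>k r. 0 \<le> W $ k $ r"
  shows "ot_value C m n \<le> semi_reduced_value C W m n"
  unfolding ot_value_def semi_reduced_value_def lp_value_def
proof (rule INF_mono)
  fix p assume p: "p \<in> lp_feasible (marginal_matrix ** W) (stack m n)"
  have "0 \<le> W *v p"
    using p assms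
    by (auto simp: lp_feasible_def less_eq_vec_def matrix_vector_mult_def intro!: sum_nonneg)
  then have "W *v p \<in> lp_feasible marginal_matrix (stack m n)"
    using p by (simp add: lp_feasible_def matrix_vector_mul_assoc)
  moreover have "(W *v p) \<bullet> vectorize C = p \<bullet> (transpose W *v vectorize C)"
    by (simp add: inner_matrix_vector_transpose)
  ultimately show "\<exists>p'\<in>lp_feasible marginal_matrix (stack m n).
      ereal (p' \<bullet> vectorize C) \<le> ereal (p \<bullet> (transpose W *v vectorize C))"
    by (metis order_refl)
qed

section \<open>The a posteriori error estimate\<close>

theorem mainTheorem2:
  fixes X :: "'a set" and Y :: "'b set"
    and x :: "'nx::finite \<Rightarrow> 'a" and y :: "'ny::finite \<Rightarrow> 'b"
    and c :: "'a \<times> 'b \<Rightarrow> real"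
    and C :: "real ^ 'ny ^ 'nx"
    and \<mu> :: "'kx::finite \<Rightarrow> real ^ 'nx" and \<nu> :: "'ky::finite \<Rightarrow> real ^ 'ny"
    and \<alpha>train :: "'r::finite \<Rightarrow> (real ^ 'kx) \<times> (real ^ 'ky)"
    and \<pi>train :: "'r \<Rightarrow> real ^ ('nx \<times> 'ny)"
    and W :: "real ^ 'r ^ ('nx \<times> 'ny)"
    and U :: "real ^ 'n::finite ^ 'nx" and V :: "real ^ 'm::finite ^ 'ny"
    and \<alpha>x :: "real ^ 'kx" and \<alpha>y :: "real ^ 'ky"
    and a :: "real ^ 'n" and b :: "real ^ 'm"
    and \<phi> :: "real ^ 'nx" and \<psi> :: "real ^ 'ny"
  assumes "bij_betw x UNIV X" and "bij_betw y UNIV Y"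
    and "\<And>s t. s \<in> X \<Longrightarrow> t \<in> Y \<Longrightarrow> 0 \<le> c (s, t)"
    and "C = cost_matrix c x y"
    and "\<And>k. prob_vector (\<mu> k)" and "\<And>l. prob_vector (\<nu> l)"
    and "\<And>r. \<alpha>train r \<in> param_set"
    and "\<And>r. ot_solution C (mixture \<mu> (fst (\<alpha>train r))) (mixture \<nu> (snd (\<alpha>train r))) (\<pi>train r)"
    and "W = snapshot_matrix \<pi>train"
    and "(\<alpha>x, \<alpha>y) \<in> param_set"
    and "reduced_value C W U V (mixture \<mu> \<alpha>x) (mixture \<nu> \<alpha>y)
       = semi_reduced_value C W (mixture \<mu> \<alpha>x) (mixture \<nu> \<alpha>y)"
    and "reduced_dual_solution C W U V (mixture \<mu> \<alpha>x) (mixture \<nu> \<alpha>y) (a, b)"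
    and "\<phi> = U *v a" and "\<psi> = V *v b"
  shows "0 \<le> reduced_value C W U V (mixture \<mu> \<alpha>x) (mixture \<nu> \<alpha>y)
             - ot_value C (mixture \<mu> \<alpha>x) (mixture \<nu> \<alpha>y)
       \<and> reduced_value C W U V (mixture \<mu> \<alpha>x) (mixture \<nu> \<alpha>y)
             - ot_value C (mixture \<mu> \<alpha>x) (mixture \<nu> \<alpha>y)
         \<le> ereal (min ((\<psi> - c_transform C \<phi>) \<bullet> mixture \<nu> \<alpha>y)
                      ((\<phi> - cbar_transform C \<psi>) \<bullet> mixture \<mu> \<alpha>x))"
proof -
  let ?m = "mixture \<mu> \<alpha>x" and ?n = "mixture \<nu> \<alpha>y"
  let ?R = "reduced_value C W U V ?m ?n" and ?I = "ot_value C ?m ?n"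
  \<comment> \<open>The columns of \<open>W\<close> are transport plans for the training parameters,
    hence nonnegative.\<close>
  have "0 \<le> W $ k $ r" for k r
    using assms(8)[of r]
    by (cases k) (simp add: assms(9) snapshot_matrix_def ot_solution_def lp_solution_def is_arg_min_def
        lp_feasible_def less_eq_vec_def)
  \<comment> \<open>The assumed equality of the reduced and semi-reduced values enters here.\<close>
  then have I_le_R: "?I \<le> ?R"
    unfolding assms(11) by (rule ot_value_le_semi_reduced_value)
  have R_le: "?R \<le> ereal (\<phi> \<bullet> ?m + \<psi> \<bullet> ?n)"
    using reduced_value_le_dual[OF assms(12)] by (simp add: assms(13,14))
  have I_ge: "ereal (\<phi> \<bullet> ?m + c_transform C \<phi> \<bullet> ?n) \<le> ?I"
    "ereal (cbar_transform C \<psi> \<bullet> ?m + \<psi> \<bullet> ?n) \<le> ?I"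
    by (intro ot_weak_duality c_transform_feasible cbar_transform_feasible)+
  \<comment> \<open>Both values lie between finite bounds, so the extended-real differences become
    real ones.\<close>
  obtain R where R: "?R = ereal R"
    using I_le_R R_le I_ge(1) by (cases ?R) auto
  obtain I where I: "?I = ereal I"
    using I_le_R R_le I_ge(1) by (cases ?I) auto
  show ?thesis
    \<comment> \<open>Subtracting the two lower bounds on \<open>I\<close> from the upper bound on
      \<open>R\<close> cancels the \<open>\<phi>\<close> term in one case and the
      \<open>\<psi>\<close> term in the other, leaving the two entries of the minimum.\<close>
    using I_le_R R_le I_ge unfolding R I by (simp add: inner_diff_left)
qed

end
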